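(* Let $\mathcal{H}$ be a real Hilbert space, let $A:\mathcal{H}\rightrightarrows\mathcal{H}$ be maximal monotone with $A^{-1}(0)\neq\emptyset$ and with $\mathrm{dom}(A)$ closed and bounded, let $\theta>0$, let $p\geq1$ be an integer, and let $(x,\lambda):[0,+\infty)\to\mathcal{H}\times(0,+\infty)$ be a global solution of \[ \dot{x}(t)+x(t)-(I+\lambda(t)A)^{-1}x(t)=0,\qquad \lambda(t)\,\|(I+\lambda(t)A)^{-1}x(t)-x(t)\|^{p-1}=\theta, \] with $x(0)\in\{x\in\mathcal{H}:0\notin Ax\}$. Define \[ \tilde z(t)=\frac{1}{\int_0^t\lambda(s)\,ds}\int_0^t\lambda(s)(I+\lambda(s)A)^{-1}x(s)\,ds,\qquad z(t)=(I+\lambda(t)A)^{-1}x(t). \] Then $\textsc{gap}(\tilde z(t))=O(t^{-(p+1)/2})$ and $\textsc{res}(z(t))=O(t^{-p/2})$ as $t\to+\infty$.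
   Context: $\mathrm{dom}(A)=\{x:Ax\neq\emptyset\}$; $(I+\lambda A)^{-1}$ is the resolvent of index $\lambda$. The gap function is $\textsc{gap}(x)=\sup_{z\in\mathrm{dom}(A)}\sup_{\xi\in Az}\langle\xi,x-z\rangle$ and the residue function is $\textsc{res}(x)=\inf_{\xi\in Ax}\|\xi\|$. *)

theory Defs
  imports "HOL-Analysis.Analysis"
begin

definition dom_op :: "('a \<Rightarrow> 'a set) \<Rightarrow> 'a set" where
  "dom_op A = {x. A x \<noteq> {}}"

definition monotone_op :: "('a::real_inner \<Rightarrow> 'a set) \<Rightarrow> bool" where
  "monotone_op A \<longleftrightarrow> (\<forall>x y u v. u \<in> A x \<longrightarrow> v \<in> A y \<longrightarrow> 0 \<le> inner (u - v) (x - y))"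

definition maximal_monotone :: "('a::real_inner \<Rightarrow> 'a set) \<Rightarrow> bool" where
  "maximal_monotone A \<longleftrightarrow> monotone_op A \<and>
     (\<forall>x u. (\<forall>y v. v \<in> A y \<longrightarrow> 0 \<le> inner (u - v) (x - y)) \<longrightarrow> u \<in> A x)"

text \<open>Resolvent (I + l A)^{-1} x: the (unique, for maximal monotone A and l > 0)
  point y with x \<in> y + l A y.\<close>
definition resolvent :: "('a::real_inner \<Rightarrow> 'a set) \<Rightarrow> real \<Rightarrow> 'a \<Rightarrow> 'a" where
  "resolvent A l x = (THE y. \<exists>\<xi>\<in>A y. x = y + l *\<^sub>R \<xi>)"

definition gap_fun :: "('a::real_inner \<Rightarrow> 'a set) \<Rightarrow> 'a \<Rightarrow> ereal" where
  "gap_fun A x = (SUP z\<in>dom_op A. SUP \<xi>\<in>A z. ereal (inner \<xi> (x - z)))"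

definition res_fun :: "('a::real_inner \<Rightarrow> 'a set) \<Rightarrow> 'a \<Rightarrow> ereal" where
  "res_fun A x = (INF \<xi>\<in>A x. ereal (norm \<xi>))"

end

theory Submission
  imports Defs
begin

text \<open>Let \<open>y t\<close> be the resolvent point of \<open>x t\<close> and \<open>phi = \<parallel>x - y\<parallel>\<close>.  Monotonicity of \<open>A\<close> gives
  \<open>phi\<^sup>2 + lam \<langle>\<xi>, y - z\<rangle> \<le> - (\<parallel>x - z\<parallel>\<^sup>2 / 2)'\<close> for every \<open>\<xi> \<in> A z\<close>.  For \<open>\<xi> = 0\<close> this bounds
  \<open>\<integral> phi\<^sup>2\<close>; since \<open>phi\<close> is nonincreasing, \<open>phi = O(t\<^sup>-\<^sup>1\<^sup>/\<^sup>2)\<close>, and the constraint turns this into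
  \<open>\<parallel>(x - y) / lam\<parallel> = phi\<^sup>p / theta\<close> small and \<open>\<integral> lam \<ge> c t\<^bsup>(p+1)/2\<^esup>\<close>.  For general \<open>\<xi>\<close> it bounds
  \<open>\<langle>\<xi>, w - z\<rangle> \<integral> lam\<close> at the ergodic mean \<open>w\<close> by \<open>\<parallel>x 0 - z\<parallel>\<^sup>2 / 2\<close>, which is uniform in \<open>z\<close> because the
  domain is bounded.\<close>

section \<open>Minimization of a strongly convex function over a closed convex set\<close>

text \<open>Direct method: strong convexity in \<open>w\<close> makes the first components of a
  minimizing sequence for \<open>r + (norm w)^2 / 2\<close> Cauchy, so completeness and closedness
  yield a minimizer \<open>(a, q)\<close>. The stated inequality is its first-order optimality
  condition.\<close>

lemma strongly_convex_minimizer: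
  fixes S :: "('b::{real_inner, complete_space} \<times> real) set"
  assumes "closed S" "convex S" "S \<noteq> {}"
    and lower: "\<And>w r. (w, r) \<in> S \<Longrightarrow> c \<le> r + (norm w)\<^sup>2 / 2"
  obtains a q where "(a, q) \<in> S" "\<And>w r. (w, r) \<in> S \<Longrightarrow> q + inner a (a - w) \<le> r"
proof -
  define val where "val = (\<lambda>s::'b \<times> real. snd s + (norm (fst s))\<^sup>2 / 2)"
  define m where "m = Inf (val ` S)"
  have bdd: "bdd_below (val ` S)"
    using lower by (intro bdd_belowI[of _ c]) (auto simp: val_def)
  have m_le: "m \<le> val s" if "s \<in> S" for s
    unfolding m_def using bdd that by (intro cInf_lower) auto
  have "\<exists>s\<in>S. val s < m + 1 / real (Suc n)" for n
  proof -
    have "Inf (val ` S) < m + 1 / real (Suc n)"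
      by (simp add: m_def)
    then show ?thesis
      using \<open>S \<noteq> {}\<close> bdd by (subst (asm) cInf_less_iff) auto
  qed
  then obtain s where s: "\<And>n. s n \<in> S" "\<And>n. val (s n) < m + 1 / real (Suc n)"
    by metis
  \<comment> \<open>The midpoint of \<open>u\<close> and \<open>v\<close> has value at least
    \<open>m\<close>; the parallelogram identity converts this into a distance bound.\<close>
  have par: "(norm (fst u - fst v))\<^sup>2 \<le> 4 * (val u + val v - 2 * m)" if "u \<in> S" "v \<in> S" for u v
  proof -
    have "(1/2) *\<^sub>R u + (1/2) *\<^sub>R v \<in> S"
      using that \<open>convex S\<close> by (intro convexD) auto
    then have "m \<le> val ((1/2) *\<^sub>R u + (1/2) *\<^sub>R v)"
      by (rule m_le)
    then show ?thesis
      by (simp add: val_def power2_norm_eq_inner algebra_simps inner_commute field_simps)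
  qed
  have val_lim: "(\<lambda>n. val (s n)) \<longlonglongrightarrow> m"
  proof (rule tendsto_sandwich)
    show "\<forall>\<^sub>F n in sequentially. m \<le> val (s n)"
      using m_le s(1) by auto
    show "\<forall>\<^sub>F n in sequentially. val (s n) \<le> m + 1 / real (Suc n)"
      using s(2) by (intro always_eventually allI less_imp_le)
    show "(\<lambda>n. m + 1 / real (Suc n)) \<longlonglongrightarrow> m"
      using tendsto_add[OF tendsto_const LIMSEQ_inverse_real_of_nat, of m]
      by (simp add: inverse_eq_divide)
  qed simp
  have "Cauchy (\<lambda>n. fst (s n))"
  proof (rule metric_CauchyI)
    fix e :: real assume "e > 0"
    \<comment> \<open>Two values within \<open>e^2 / 8\<close> of \<open>m\<close> make the bound in
      \<open>par\<close> less than \<open>4 * (e^2 / 4) = e^2\<close>.\<close>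
    then have "m < m + e\<^sup>2 / 8" by simp
    then have "\<forall>\<^sub>F n in sequentially. val (s n) < m + e\<^sup>2 / 8"
      using val_lim by (rule order_tendstoD(2)[rotated])
    then obtain N where N: "\<And>n. n \<ge> N \<Longrightarrow> val (s n) < m + e\<^sup>2 / 8"
      by (auto simp: eventually_sequentially)
    have "dist (fst (s i)) (fst (s j)) < e" if "i \<ge> N" "j \<ge> N" for i j
    proof -
      have "(norm (fst (s i) - fst (s j)))\<^sup>2 < e\<^sup>2"
        using par[OF s(1)[of i] s(1)[of j]] N[OF that(1)] N[OF that(2)] by simp
      then show ?thesis
        using \<open>e > 0\<close> by (simp add: dist_norm power_less_imp_less_base)
    qed
    then show "\<exists>M. \<forall>i\<ge>M. \<forall>j\<ge>M. dist (fst (s i)) (fst (s j)) < e" by blast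
  qed
  then obtain a where a: "(\<lambda>n. fst (s n)) \<longlonglongrightarrow> a"
    using Cauchy_convergent convergent_def by blast
  \<comment> \<open>Chosen so that \<open>val (a, q) = m\<close>; the second components converge
    because the values and the norms do.\<close>
  define q where "q = m - (norm a)\<^sup>2 / 2"
  have "(\<lambda>n. val (s n) - (norm (fst (s n)))\<^sup>2 / 2) \<longlonglongrightarrow> q"
    unfolding q_def by (intro tendsto_intros val_lim a) auto
  then have "(\<lambda>n. snd (s n)) \<longlonglongrightarrow> q"
    by (simp add: val_def)
  then have "(\<lambda>n. (fst (s n), snd (s n))) \<longlonglongrightarrow> (a, q)"
    by (intro tendsto_Pair a)
  then have aq: "(a, q) \<in> S"
    using \<open>closed S\<close> s(1) closed_sequentially[of S s] by simp
  have "q + inner a (a - w) \<le> r" if wr: "(w, r) \<in> S" for w r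
  proof -
    \<comment> \<open>Minimality is tested along the segment from \<open>(a, q)\<close> to
      \<open>(w, r)\<close> and divided by \<open>h\<close>; letting \<open>h\<close> tend to 0
      removes the quadratic term.\<close>
    have pos: "0 \<le> (r - q + inner a (w - a)) + h * ((norm (w - a))\<^sup>2 / 2)" if h: "0 < h" "h \<le> 1" for h
    proof -
      have "(1 - h) *\<^sub>R (a, q) + h *\<^sub>R (w, r) \<in> S"
        using aq wr \<open>convex S\<close> h by (intro convexD) auto
      then have "m \<le> val ((1 - h) *\<^sub>R (a, q) + h *\<^sub>R (w, r))"
        by (rule m_le)
      also have "\<dots> = q + h * (r - q) + (norm (a + h *\<^sub>R (w - a)))\<^sup>2 / 2"
        by (simp add: val_def algebra_simps)
      also have "(norm (a + h *\<^sub>R (w - a)))\<^sup>2 = (norm a)\<^sup>2 + 2 * h * inner a (w - a) + h\<^sup>2 * (norm (w - a))\<^sup>2"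
        unfolding power2_norm_eq_inner
        by (simp add: inner_add_left inner_add_right inner_commute power2_eq_square)
      finally have "0 \<le> h * ((r - q + inner a (w - a)) + h * ((norm (w - a))\<^sup>2 / 2))"
        unfolding q_def power2_norm_eq_inner
        by (simp add: inner_diff_left inner_diff_right inner_commute algebra_simps power2_eq_square
            add_divide_distrib diff_divide_distrib)
      then show ?thesis using h by (simp add: zero_le_mult_iff)
    qed
    have "((\<lambda>h. (r - q + inner a (w - a)) + h * ((norm (w - a))\<^sup>2 / 2)) \<longlongrightarrow>
          (r - q + inner a (w - a)) + 0 * ((norm (w - a))\<^sup>2 / 2)) (at_right 0)"
      by (intro tendsto_intros)
    moreover have "\<forall>\<^sub>F h in at_right 0. 0 \<le> (r - q + inner a (w - a)) + h * ((norm (w - a))\<^sup>2 / 2)"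
      using pos by (auto simp: eventually_at_right_field intro!: exI[of _ 1])
    ultimately have "0 \<le> (r - q + inner a (w - a)) + 0 * ((norm (w - a))\<^sup>2 / 2)"
      by (intro tendsto_lowerbound[where F = "at_right (0::real)"]) auto
    then show ?thesis by (simp add: inner_diff_right)
  qed
  with aq show thesis by (rule that)
qed

section \<open>Minty's theorem for maximal monotone operators\<close>

lemma maximal_monotoneD:
  assumes "maximal_monotone A" "u \<in> A x" "v \<in> A y"
  shows "0 \<le> inner (u - v) (x - y)"
  using assms unfolding maximal_monotone_def monotone_op_def by blast

lemma maximal_monotoneI:
  assumes "maximal_monotone A" "\<And>y v. v \<in> A y \<Longrightarrow> 0 \<le> inner (u - v) (x - y)"
  shows "u \<in> A x"
  using assms unfolding maximal_monotone_def by blast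

text \<open>Minty's theorem at the origin: the set \<open>S\<close> below is the epigraph of the Fitzpatrick function
  \<open>F (x, u) = sup {\<langle>x, v\<rangle> + \<langle>y, u\<rangle> - \<langle>y, v\<rangle> | v \<in> A y}\<close>, which dominates \<open>\<langle>x, u\<rangle>\<close>.  At the minimizer
  \<open>(a, b)\<close> of \<open>F + \<parallel>\<cdot>\<parallel>\<^sup>2 / 2\<close> the optimality condition puts \<open>(- b, - a)\<close> in the graph of \<open>A\<close> and
  forces \<open>b = - a\<close>.\<close>

lemma Minty_zero:
  fixes A :: "'a::{real_inner, complete_space} \<Rightarrow> 'a set"
  assumes A: "maximal_monotone A"
  shows "\<exists>a. - a \<in> A a"
proof -
  define S where
    "S = (\<Inter>(y, v)\<in>{(y, v). v \<in> A y}. {s. inner (fst (fst s)) v + inner y (snd (fst s)) - inner y v \<le> snd s})"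
  have mem_S: "((x, u), r) \<in> S \<longleftrightarrow> (\<forall>y v. v \<in> A y \<longrightarrow> inner x v + inner y u - inner y v \<le> r)" for x u r
    by (auto simp: S_def)
  have "closed S"
    unfolding S_def by (intro closed_INT) (auto intro!: closed_Collect_le continuous_intros)
  have "convex S"
  proof (rule convexI)
    fix s1 s2 and h k :: real
    assume s: "s1 \<in> S" "s2 \<in> S" and hk: "0 \<le> h" "0 \<le> k" "h + k = 1"
    obtain x1 u1 r1 x2 u2 r2 where eq: "s1 = ((x1, u1), r1)" "s2 = ((x2, u2), r2)"
      by (metis surj_pair)
    have "inner (h *\<^sub>R x1 + k *\<^sub>R x2) v + inner y (h *\<^sub>R u1 + k *\<^sub>R u2) - inner y v \<le> h * r1 + k * r2"
      if v: "v \<in> A y" for y v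
    proof -
      have "h * (inner x1 v + inner y u1 - inner y v) + k * (inner x2 v + inner y u2 - inner y v)
          \<le> h * r1 + k * r2"
        using s v hk by (intro add_mono mult_left_mono) (auto simp: eq mem_S)
      moreover have "inner y v = h * inner y v + k * inner y v"
        using hk(3) by (metis distrib_right mult_1)
      ultimately show ?thesis
        by (simp add: inner_add_left inner_add_right algebra_simps)
    qed
    then show "h *\<^sub>R s1 + k *\<^sub>R s2 \<in> S"
      by (simp add: eq mem_S)
  qed
  have dominates: "inner x u \<le> r" if "((x, u), r) \<in> S" for x u r
  proof -
    \<comment> \<open>If \<open>(x, u)\<close> is in the graph, it serves as its own witness;
      otherwise maximality supplies a graph point violating monotonicity. Inserting the witness into
      \<open>mem_S\<close> gives the claim.\<close>
    obtain y v where "v \<in> A y" "inner (u - v) (x - y) \<le> 0"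
    proof (cases "u \<in> A x")
      case True
      then show ?thesis using that[of u x] by simp
    next
      case False
      then show ?thesis
        using maximal_monotoneI[OF A, of u x] that by (meson linear)
    qed
    then show ?thesis
      using that by (fastforce simp: mem_S inner_diff_left inner_diff_right inner_commute)
  qed
  \<comment> \<open>For an empty graph the maximality condition would hold vacuously and put every
    point into it.\<close>
  obtain y0 v0 where "v0 \<in> A y0"
    using maximal_monotoneI[OF A] by blast
  then have "((y0, v0), inner y0 v0) \<in> S"
    using maximal_monotoneD[OF A]
    by (fastforce simp: mem_S inner_diff_left inner_diff_right inner_commute)
  then have "S \<noteq> {}" by blast
  have "0 \<le> r + (norm w)\<^sup>2 / 2" if "(w, r) \<in> S" for w r
  proof -
    obtain x u where w: "w = (x, u)" by fastforce
    have "0 \<le> (norm (x + u))\<^sup>2" by simp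
    also have "\<dots> = (norm w)\<^sup>2 + 2 * inner x u"
      unfolding power2_norm_eq_inner
      by (simp add: w inner_add_left inner_add_right inner_commute)
    finally show ?thesis using dominates that w by fastforce
  qed
  from strongly_convex_minimizer[OF \<open>closed S\<close> \<open>convex S\<close> \<open>S \<noteq> {}\<close> this]
  obtain c q where cq: "(c, q) \<in> S" "\<And>w r. (w, r) \<in> S \<Longrightarrow> q + inner c (c - w) \<le> r" by metis
  obtain a b where c: "c = (a, b)" by fastforce
  have q: "inner a b \<le> q" using cq(1) dominates c by simp
  \<comment> \<open>Optimality is tested at the graph point \<open>((y, v), inner y v)\<close> of
    \<open>S\<close>; \<open>inner a b \<le> q\<close> completes the square on the left.\<close>
  have key: "inner (a + b) (a + b) \<le> inner (- a - v) (- b - y)" if v: "v \<in> A y" for y v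
  proof -
    have "((y, v), inner y v) \<in> S"
      using maximal_monotoneD[OF A] v
      by (fastforce simp: mem_S inner_diff_left inner_diff_right inner_commute)
    from cq(2)[OF this] have "q + inner a (a - y) + inner b (b - v) \<le> inner y v"
      by (simp add: c)
    then show ?thesis using q
      by (simp add: inner_diff_left inner_diff_right inner_add_left inner_add_right inner_commute)
  qed
  have mem: "- a \<in> A (- b)"
    using key by (intro maximal_monotoneI[OF A]) (meson inner_ge_zero order_trans)
  \<comment> \<open>At \<open>y = - b\<close>, \<open>v = - a\<close> the right-hand side of
    \<open>key\<close> vanishes.\<close>
  from key[OF mem] have "a + b = 0"
    by (metis diff_self inner_gt_zero_iff inner_zero_left not_less)
  then have "a = - b" by (simp add: eq_neg_iff_add_eq_0)
  with mem show ?thesis by metis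
qed

text \<open>Scaling and translation reduce this to \<open>Minty_zero\<close>: \<open>B\<close> is
  the operator \<open>l A - w\<close>, and \<open>- a \<in> B a\<close> says that
  \<open>w - a\<close> lies in \<open>l A a\<close>.\<close>

lemma Minty:
  fixes A :: "'a::{real_inner, complete_space} \<Rightarrow> 'a set"
  assumes A: "maximal_monotone A" and l: "l > 0"
  shows "\<exists>y. \<exists>\<xi>\<in>A y. w = y + l *\<^sub>R \<xi>"
proof -
  define B where "B = (\<lambda>y. {u. (1 / l) *\<^sub>R (u + w) \<in> A y})"
  have "maximal_monotone B"
    unfolding maximal_monotone_def monotone_op_def
  proof (intro conjI allI impI)
    fix x y u v assume "u \<in> B x" "v \<in> B y"
    then have "0 \<le> inner ((1 / l) *\<^sub>R (u + w) - (1 / l) *\<^sub>R (v + w)) (x - y)"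
      by (intro maximal_monotoneD[OF A]) (auto simp: B_def)
    also have "\<dots> = (1 / l) * inner (u - v) (x - y)"
      by (simp flip: scaleR_diff_right)
    finally show "0 \<le> inner (u - v) (x - y)"
      using l by (simp add: zero_le_divide_iff)
  next
    fix x u assume *: "\<forall>y v. v \<in> B y \<longrightarrow> 0 \<le> inner (u - v) (x - y)"
    have "(1 / l) *\<^sub>R (u + w) \<in> A x"
    proof (rule maximal_monotoneI[OF A])
      fix y v assume "v \<in> A y"
      then have "l *\<^sub>R v - w \<in> B y" using l by (simp add: B_def)
      then have "0 \<le> inner (u - (l *\<^sub>R v - w)) (x - y)" using * by blast
      also have "u - (l *\<^sub>R v - w) = l *\<^sub>R ((1 / l) *\<^sub>R (u + w) - v)"
        using l by (simp add: algebra_simps)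
      finally show "0 \<le> inner ((1 / l) *\<^sub>R (u + w) - v) (x - y)"
        using l by (simp add: zero_le_mult_iff)
    qed
    then show "u \<in> B x" by (simp add: B_def)
  qed
  then obtain a where "- a \<in> B a" using Minty_zero by blast
  then have "(1 / l) *\<^sub>R (w - a) \<in> A a" by (simp add: B_def)
  moreover have "w = a + l *\<^sub>R ((1 / l) *\<^sub>R (w - a))" using l by simp
  ultimately show ?thesis by blast
qed

section \<open>Resolvents and their dependence on point and index\<close>

text \<open>Monotonicity between \<open>u\<close> and \<open>v\<close>, multiplied by
  \<open>l\<close>; the term with \<open>1 - l / k\<close> accounts for the different indices.
  Uniqueness, continuity, monotonicity in the index and firm nonexpansiveness all follow from
  it.\<close>

lemma resolvent_estimate:
  fixes A :: "'a::real_inner \<Rightarrow> 'a set"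
  assumes A: "maximal_monotone A" and l: "l > 0" and k: "k > 0"
    and u: "(1 / l) *\<^sub>R (w - u) \<in> A u" and v: "(1 / k) *\<^sub>R (x - v) \<in> A v"
  shows "(norm (u - v))\<^sup>2 \<le> inner (w - x + (1 - l / k) *\<^sub>R (x - v)) (u - v)"
proof -
  have "0 \<le> l * inner ((1 / l) *\<^sub>R (w - u) - (1 / k) *\<^sub>R (x - v)) (u - v)"
    using maximal_monotoneD[OF A u v] l by simp
  also have "\<dots> = inner (w - u - (l / k) *\<^sub>R (x - v)) (u - v)"
    using l by (simp add: inner_diff_left algebra_simps)
  also have "w - u - (l / k) *\<^sub>R (x - v) = (w - x + (1 - l / k) *\<^sub>R (x - v)) - (u - v)"
    by (simp add: algebra_simps)
  finally show ?thesis
    by (simp add: inner_diff_left power2_norm_eq_inner)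
qed

text \<open>Justifies the definite description in \<open>resolvent\<close>: \<open>Minty\<close>
  gives existence, and \<open>resolvent_estimate\<close> with equal indices gives
  uniqueness.\<close>

lemma resolvent_mem:
  fixes A :: "'a::{real_inner, complete_space} \<Rightarrow> 'a set"
  assumes A: "maximal_monotone A" and l: "l > 0"
  shows "(1 / l) *\<^sub>R (w - resolvent A l w) \<in> A (resolvent A l w)"
proof -
  have eq: "(\<exists>\<xi>\<in>A y. w = y + l *\<^sub>R \<xi>) \<longleftrightarrow> (1 / l) *\<^sub>R (w - y) \<in> A y" for y
  proof
    assume "(1 / l) *\<^sub>R (w - y) \<in> A y"
    then show "\<exists>\<xi>\<in>A y. w = y + l *\<^sub>R \<xi>"
      using l by (intro bexI[of _ "(1 / l) *\<^sub>R (w - y)"]) auto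
  qed (use l in auto)
  have "\<exists>!y. (1 / l) *\<^sub>R (w - y) \<in> A y"
  proof (rule ex_ex1I)
    show "\<exists>y. (1 / l) *\<^sub>R (w - y) \<in> A y"
      using Minty[OF A l, of w] unfolding eq .
    show "u = v" if "(1 / l) *\<^sub>R (w - u) \<in> A u" "(1 / l) *\<^sub>R (w - v) \<in> A v" for u v
      using resolvent_estimate[OF A l l that] l by simp
  qed
  then show ?thesis
    unfolding resolvent_def eq by (rule theI')
qed

lemma norm_resolvent_diff_le:
  fixes A :: "'a::{real_inner, complete_space} \<Rightarrow> 'a set"
  assumes A: "maximal_monotone A" and l: "l > 0" and k: "k > 0"
  shows "norm (resolvent A l w - resolvent A k x)
       \<le> norm (w - x) + \<bar>1 - l / k\<bar> * norm (x - resolvent A k x)"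
proof -
  let ?d = "resolvent A l w - resolvent A k x"
  let ?e = "w - x + (1 - l / k) *\<^sub>R (x - resolvent A k x)"
  have "(norm ?d)\<^sup>2 \<le> inner ?e ?d"
    by (rule resolvent_estimate[OF A l k resolvent_mem[OF A l] resolvent_mem[OF A k]])
  also have "\<dots> \<le> norm ?e * norm ?d" by (rule norm_cauchy_schwarz)
  finally have "norm ?d \<le> norm ?e"
    by (cases "?d = 0") (auto simp: power2_eq_square)
  also have "\<dots> \<le> norm (w - x) + \<bar>1 - l / k\<bar> * norm (x - resolvent A k x)"
    by (metis norm_scaleR norm_triangle_ineq)
  finally show ?thesis .
qed

lemma continuous_on_resolvent:
  fixes A :: "'a::{real_inner, complete_space} \<Rightarrow> 'a set"
  assumes A: "maximal_monotone A" and pos: "\<And>t. t \<in> S \<Longrightarrow> l t > 0"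
    and l: "continuous_on S l" and x: "continuous_on S x"
  shows "continuous_on S (\<lambda>t. resolvent A (l t) (x t))"
  unfolding continuous_on_def
proof
  fix s assume s: "s \<in> S"
  let ?b = "\<lambda>t. norm (x t - x s) + \<bar>1 - l t / l s\<bar> * norm (x s - resolvent A (l s) (x s))"
  have lim: "(l \<longlongrightarrow> l s) (at s within S)" "(x \<longlongrightarrow> x s) (at s within S)"
    using l x s by (auto simp: continuous_on_def)
  have "(?b \<longlongrightarrow> norm (x s - x s) + \<bar>1 - l s / l s\<bar> * norm (x s - resolvent A (l s) (x s)))
      (at s within S)"
    using pos[OF s] by (intro tendsto_intros lim) auto
  then have b: "(?b \<longlongrightarrow> 0) (at s within S)"
    using pos[OF s] by simp
  have "((\<lambda>t. resolvent A (l t) (x t) - resolvent A (l s) (x s)) \<longlongrightarrow> 0) (at s within S)"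
  proof (rule Lim_null_comparison[OF _ b])
    show "\<forall>\<^sub>F t in at s within S. norm (resolvent A (l t) (x t) - resolvent A (l s) (x s)) \<le> ?b t"
      unfolding eventually_at_filter
      by (intro always_eventually allI impI norm_resolvent_diff_le A pos s)
  qed
  then show "((\<lambda>t. resolvent A (l t) (x t)) \<longlongrightarrow> resolvent A (l s) (x s)) (at s within S)"
    by (rule Lim_null[THEN iffD2])
qed

text \<open>With \<open>u\<close>, \<open>v\<close> the resolvents of index \<open>l\<close>,
  \<open>k\<close>, expanding the square of \<open>x - u = (x - v) - (u - v)\<close> leaves
  \<open>- 2 * g + (norm (u - v))^2\<close>. This is nonpositive since the last square is at most
  \<open>c * g\<close> with \<open>c \<le> 1\<close>.\<close>

lemma norm_diff_resolvent_mono: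
  fixes A :: "'a::{real_inner, complete_space} \<Rightarrow> 'a set"
  assumes A: "maximal_monotone A" and l: "0 < l" and lk: "l \<le> k"
  shows "norm (x - resolvent A l x) \<le> norm (x - resolvent A k x)"
proof -
  let ?u = "resolvent A l x" and ?v = "resolvent A k x"
  define c where "c = 1 - l / k"
  define g where "g = inner (x - ?v) (?u - ?v)"
  have c: "0 \<le> c" "c \<le> 1" using l lk by (auto simp: c_def)
  have d: "(norm (?u - ?v))\<^sup>2 \<le> c * g"
    using resolvent_estimate[OF A l, of k x ?u x ?v] resolvent_mem[OF A] l lk
    by (simp add: c_def g_def)
  have "0 \<le> g"
  \<comment> \<open>A negative \<open>g\<close> would force \<open>?u = ?v\<close>, and then
    \<open>g = 0\<close>.\<close>
  proof (rule ccontr)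
    assume "\<not> 0 \<le> g"
    then have "(norm (?u - ?v))\<^sup>2 \<le> 0"
      using d c mult_nonneg_nonpos[of c g] by linarith
    then show False using \<open>\<not> 0 \<le> g\<close> by (simp add: g_def)
  qed
  then have "c * g \<le> 2 * g" using c by (intro mult_right_mono) auto
  have "x - ?u = (x - ?v) - (?u - ?v)" by simp
  then have "(norm (x - ?u))\<^sup>2 = (norm (x - ?v))\<^sup>2 - 2 * g + (norm (?u - ?v))\<^sup>2"
    unfolding g_def power2_norm_eq_inner
    by (simp add: inner_diff_left inner_diff_right inner_commute)
  also have "\<dots> \<le> (norm (x - ?v))\<^sup>2"
    using d \<open>c * g \<le> 2 * g\<close> by linarith
  finally show ?thesis by (rule power2_le_imp_le) simp
qed

text \<open>\<open>M\<close> is \<open>l\<close> times the Yosida approximation; firm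
  nonexpansiveness passes from the resolvent to its complement \<open>I - J\<close>.\<close>

lemma diff_resolvent_firmly_nonexpansive:
  fixes A :: "'a::{real_inner, complete_space} \<Rightarrow> 'a set"
  assumes A: "maximal_monotone A" and l: "l > 0"
  defines "M \<equiv> \<lambda>x. x - resolvent A l x"
  shows "(norm (M w - M x))\<^sup>2 \<le> inner (M w - M x) (w - x)"
proof -
  let ?d = "resolvent A l w - resolvent A l x"
  have "inner ?d ?d \<le> inner (w - x) ?d"
    using resolvent_estimate[OF A l l resolvent_mem[OF A l] resolvent_mem[OF A l], of w x] l
    by (simp add: power2_norm_eq_inner)
  moreover have "M w - M x = (w - x) - ?d" by (simp add: M_def)
  ultimately show ?thesis
    by (simp only: power2_norm_eq_inner inner_diff_left inner_diff_right inner_commute)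
qed

text \<open>Along the Euler step \<open>x - h M x\<close> of the Yosida flow the residual does not increase, so it
  increases from \<open>x\<close> to \<open>w\<close> by at most the discretization error.\<close>

lemma norm_diff_resolvent_step:
  fixes A :: "'a::{real_inner, complete_space} \<Rightarrow> 'a set"
  assumes A: "maximal_monotone A" and l: "l > 0" and h: "0 < h" "h \<le> 1"
  defines "M \<equiv> \<lambda>x. x - resolvent A l x"
  shows "norm (M w) \<le> norm (M x) + norm (w - x + h *\<^sub>R M x)"
proof -
  note fne = diff_resolvent_firmly_nonexpansive[OF A l, folded M_def]
  have nonexp: "norm (M a - M b) \<le> norm (a - b)" for a b
  proof -
    have "(norm (M a - M b))\<^sup>2 \<le> norm (M a - M b) * norm (a - b)"
      using fne[of a b] norm_cauchy_schwarz order_trans unfolding M_def by blast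
    then show ?thesis
      by (cases "M a = M b") (auto simp: power2_eq_square)
  qed
  define e where "e = x - h *\<^sub>R M x"
  have "norm (M e) \<le> norm (M x)"
  proof -
    let ?D = "M e - M x"
    \<comment> \<open>Firm nonexpansiveness with \<open>e - x = - (h *\<^sub>R M x)\<close>.
      Together with \<open>h \<le> 1\<close> it makes the increment of the squared residual
      nonpositive.\<close>
    have "(norm ?D)\<^sup>2 \<le> - (h * inner ?D (M x))"
      using fne[of e x] by (simp add: M_def e_def)
    moreover have "h * (norm ?D)\<^sup>2 \<le> 1 * (norm ?D)\<^sup>2"
      using h by (intro mult_right_mono) auto
    moreover have "h * ((norm ?D)\<^sup>2 + 2 * inner ?D (M x)) = h * (norm ?D)\<^sup>2 + 2 * (h * inner ?D (M x))"
      by (simp add: algebra_simps)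
    ultimately have "h * ((norm ?D)\<^sup>2 + 2 * inner ?D (M x)) \<le> 0"
      using zero_le_power2[of "norm ?D"] by linarith
    then have "(norm ?D)\<^sup>2 + 2 * inner ?D (M x) \<le> 0"
      using h by (simp add: mult_le_0_iff)
    moreover have "M e = ?D + M x" by simp
    then have "(norm (M e))\<^sup>2 = (norm ?D)\<^sup>2 + 2 * inner ?D (M x) + (norm (M x))\<^sup>2"
      unfolding power2_norm_eq_inner
      by (smt (verit) inner_add_left inner_add_right inner_commute)
    ultimately have "(norm (M e))\<^sup>2 \<le> (norm (M x))\<^sup>2" by linarith
    then show ?thesis by (rule power2_le_imp_le) simp
  qed
  moreover have "norm (M w) \<le> norm (M e) + norm (M w - M e)"
    by (rule norm_triangle_sub)
  moreover have "norm (M w - M e) \<le> norm (w - x + h *\<^sub>R M x)"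
    using nonexp[of w e] by (simp add: e_def algebra_simps)
  ultimately show ?thesis by linarith
qed

section \<open>A Dini criterion for monotonicity, and integrals in Hilbert space\<close>

text \<open>The last point where \<open>f t \<le> f a + e * (t - a)\<close> must be
  \<open>b\<close>, since the Dini condition extends the inequality past any earlier point; then
  \<open>e\<close> tends to 0. It serves for \<open>phi\<close>, of which only continuity is
  established.\<close>

lemma Dini_nonpos_imp_le:
  fixes f :: "real \<Rightarrow> real"
  assumes ab: "a \<le> b" and cont: "continuous_on {a..b} f"
    and dini: "\<And>s e. a \<le> s \<Longrightarrow> s < b \<Longrightarrow> e > 0 \<Longrightarrow> \<forall>\<^sub>F t in at_right s. f t \<le> f s + e * (t - s)"
  shows "f b \<le> f a"
proof -
  have bound: "f b \<le> f a + e * (b - a)" if e: "e > 0" for e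
  proof -
    define S where "S = {t \<in> {a..b}. f t - e * (t - a) \<le> f a}"
    have "closed S"
      unfolding S_def by (intro continuous_on_closed_Collect_le continuous_intros cont)
    moreover have "bounded S"
      by (rule bounded_subset[of "{a..b}"]) (auto simp: S_def)
    ultimately have "compact S" by (simp add: compact_eq_bounded_closed)
    moreover have "a \<in> S" using ab by (simp add: S_def)
    ultimately obtain c where c: "c \<in> S" "\<And>t. t \<in> S \<Longrightarrow> t \<le> c"
      using compact_attains_sup[of S] by auto
    have "c = b"
    proof (rule ccontr)
      assume "c \<noteq> b"
      then have "c < b" "a \<le> c" using c by (auto simp: S_def)
      then have "\<forall>\<^sub>F t in at_right c. f t \<le> f c + e * (t - c) \<and> c < t \<and> t < b"
        using dini[of c e] e
        by (intro eventually_conj) (auto simp: eventually_at_right_less eventually_at_right_field)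
      then obtain t where t: "f t \<le> f c + e * (t - c)" "c < t" "t < b"
        using eventually_happens'[OF trivial_limit_at_right_real] by blast
      then have "t \<in> S" using c(1) by (auto simp: S_def algebra_simps)
      then show False using c(2) t(2) by force
    qed
    then show ?thesis using c(1) by (simp add: S_def)
  qed
  show ?thesis
  proof (cases "a = b")
    case False
    show ?thesis
    proof (rule field_le_epsilon)
      fix e :: real assume "e > 0"
      then show "f b \<le> f a + e"
        using bound[of "e / (b - a)"] ab False by simp
    qed
  qed simp
qed

text \<open>The sort of \<open>'b\<close> is not an instance of \<open>banach\<close>, so \<open>integrable_continuous_interval\<close> is not
  available; the Cauchy criterion is pulled back along the isometric embedding into the dual.\<close>

lemma integrable_continuous_hilbert:
  fixes f :: "real \<Rightarrow> 'b::{real_inner, complete_space}"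
  assumes "continuous_on {a..b} f"
  shows "f integrable_on {a..b}"
proof -
  let ?J = "blinfun_inner_left :: 'b \<Rightarrow> 'b \<Rightarrow>\<^sub>L real"
  interpret J: bounded_linear ?J by (rule bounded_linear_blinfun_inner_left)
  have norm_le: "norm v \<le> norm (?J v)" for v
  proof (cases "v = 0")
    case False
    have "norm v * norm v \<le> norm (?J v) * norm v"
      using norm_blinfun[of "?J v" v] by (simp flip: power2_norm_eq_inner power2_eq_square)
    then show ?thesis using False by simp
  qed simp
  have sum_J: "(\<Sum>(x, K)\<in>D. measure lborel K *\<^sub>R ?J (f x)) = ?J (\<Sum>(x, K)\<in>D. measure lborel K *\<^sub>R f x)"
    for D :: "(real \<times> real set) set"
    by (simp add: J.sum J.scaleR case_prod_unfold)
  have "(\<lambda>x. ?J (f x)) integrable_on cbox a b"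
    using assms by (intro integrable_continuous J.continuous_on) simp
  then show ?thesis
    unfolding integrable_Cauchy box_real(2)[symmetric] sum_J J.diff[symmetric]
    by (meson norm_le order_le_less_trans)
qed

section \<open>The flow and the monotone decay of its residual\<close>

locale resolvent_flow =
  fixes A :: "'a::{real_inner, complete_space} \<Rightarrow> 'a set"
    and theta :: real and p :: nat
    and x :: "real \<Rightarrow> 'a" and lam :: "real \<Rightarrow> real"
  assumes maxmono: "maximal_monotone A"
    and theta_pos: "theta > 0"
    and p_ge: "p \<ge> 1"
    and lam_pos: "\<And>t. t \<ge> 0 \<Longrightarrow> lam t > 0"
    and lam_cont: "continuous_on {0..} lam"
    and ode: "\<And>t. t \<ge> 0 \<Longrightarrow>
       (x has_vector_derivative (resolvent A (lam t) (x t) - x t)) (at t within {0..})"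
    and alg: "\<And>t. t \<ge> 0 \<Longrightarrow>
       lam t * norm (resolvent A (lam t) (x t) - x t) ^ (p - 1) = theta"
begin

definition y :: "real \<Rightarrow> 'a" where
  "y t = resolvent A (lam t) (x t)"

definition phi :: "real \<Rightarrow> real" where
  "phi t = norm (x t - y t)"

lemma phi_nonneg: "phi t \<ge> 0"
  by (simp add: phi_def)

lemma lam_phi: "t \<ge> 0 \<Longrightarrow> lam t * phi t ^ (p - 1) = theta"
  using alg by (simp add: phi_def y_def norm_minus_commute)

lemma mem_y: "t \<ge> 0 \<Longrightarrow> (1 / lam t) *\<^sub>R (x t - y t) \<in> A (y t)"
  unfolding y_def by (intro resolvent_mem maxmono lam_pos)

lemma x_cont: "continuous_on {0..} x"
  unfolding continuous_on_eq_continuous_within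
  using ode by (auto intro: has_vector_derivative_continuous)

lemma y_cont: "continuous_on {0..} y"
  unfolding y_def using maxmono lam_pos lam_cont x_cont by (intro continuous_on_resolvent) auto

lemma phi_cont: "continuous_on {0..} phi"
  unfolding phi_def by (intro continuous_intros x_cont y_cont)

text \<open>If \<open>phi\<close> increased from \<open>u\<close> to \<open>t\<close>, the constraint would force \<open>lam t \<le> lam u\<close>, so the residual at
  \<open>x t\<close> can be measured with the frozen index \<open>lam u\<close>, for which it grows only by \<open>o(t - u)\<close>.\<close>

lemma phi_antimono:
  assumes "0 \<le> s" "s \<le> t"
  shows "phi t \<le> phi s"
proof (rule Dini_nonpos_imp_le[OF assms(2)])
  show "continuous_on {s..t} phi"
    using phi_cont by (rule continuous_on_subset) (use assms in auto)
next
  fix u e :: real assume u: "s \<le> u" "u < t" and e: "e > 0"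
  have u0: "0 \<le> u" using u assms by simp
  have "\<forall>\<^sub>F v in at u within {0..}. norm (x v - x u - (v - u) *\<^sub>R (y u - x u)) \<le> e * norm (v - u)"
    using ode[OF u0] e unfolding has_vector_derivative_def has_derivative_within_alt2 y_def by blast
  then have ev: "\<forall>\<^sub>F v in at_right u. norm (x v - x u - (v - u) *\<^sub>R (y u - x u)) \<le> e * norm (v - u)"
    by (rule filter_leD[rotated]) (use u0 in \<open>auto intro!: at_le\<close>)
  \<comment> \<open>The step length \<open>v - u\<close> must lie in \<open>(0, 1]\<close> for
    \<open>norm_diff_resolvent_step\<close>.\<close>
  have "\<forall>\<^sub>F v in at_right u. u < v \<and> v < u + 1"
    by (auto simp: eventually_at_right_field intro: exI[of _ "u + 1"])
  with ev show "\<forall>\<^sub>F v in at_right u. phi v \<le> phi u + e * (v - u)"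
  proof eventually_elim
    case (elim v)
    have v0: "0 \<le> v" using elim u0 by simp
    show ?case
    proof (cases "phi v \<le> phi u")
      case True
      then show ?thesis using e elim by (smt (verit) mult_nonneg_nonneg)
    next
      case False
      have "lam v * phi u ^ (p - 1) \<le> lam v * phi v ^ (p - 1)"
        using False lam_pos[OF v0] phi_nonneg by (intro mult_left_mono power_mono) auto
      then have "lam v * phi u ^ (p - 1) \<le> lam u * phi u ^ (p - 1)"
        using lam_phi u0 v0 by simp
      \<comment> \<open>The constraint makes its product with \<open>lam u\<close> equal to
        \<open>theta > 0\<close>; this includes \<open>p = 1\<close>, where the power is 1.\<close>
      moreover have "phi u ^ (p - 1) > 0"
        using lam_phi[OF u0] theta_pos lam_pos[OF u0] by (metis zero_less_mult_pos)
      ultimately have "lam v \<le> lam u" by simp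
      then have "phi v \<le> norm (x v - resolvent A (lam u) (x v))"
        unfolding phi_def y_def by (intro norm_diff_resolvent_mono maxmono lam_pos v0)
      also have "\<dots> \<le> phi u + norm (x v - x u + (v - u) *\<^sub>R (x u - y u))"
        unfolding phi_def y_def
        using elim by (intro norm_diff_resolvent_step maxmono lam_pos u0) auto
      also have "x v - x u + (v - u) *\<^sub>R (x u - y u) = x v - x u - (v - u) *\<^sub>R (y u - x u)"
        by (simp add: algebra_simps)
      also have "norm \<dots> \<le> e * (v - u)" using elim by simp
      finally show ?thesis by simp
    qed
  qed
qed

section \<open>Energy estimate and convergence rates\<close>

lemma energy_integral_le:
  assumes t: "t \<ge> 0" and xi: "\<xi> \<in> A z"
  shows "integral {0..t} (\<lambda>s. (phi s)\<^sup>2 + lam s * inner \<xi> (y s - z)) \<le> (norm (x 0 - z))\<^sup>2 / 2"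
proof -
  let ?N = "\<lambda>s. inner (x s - z) (x s - z)"
  have deriv: "(?N has_vector_derivative (2 * inner (x s - z) (y s - x s))) (at s within {0..t})"
    if "s \<in> {0..t}" for s
  proof -
    have "((\<lambda>s. x s - z) has_vector_derivative (y s - x s)) (at s within {0..t})"
      using ode[of s] that unfolding y_def
      by (auto intro!: derivative_eq_intros intro: has_vector_derivative_within_subset)
    from bounded_bilinear.has_vector_derivative[OF bounded_bilinear_inner this this]
    show ?thesis by (simp add: inner_commute)
  qed
  have "((\<lambda>s. 2 * inner (x s - z) (y s - x s)) has_integral (?N t - ?N 0)) {0..t}"
    using t deriv by (rule fundamental_theorem_of_calculus)
  from has_integral_mult_right[OF this, of "- (1/2)"]
  have *: "((\<lambda>s. - inner (x s - z) (y s - x s)) has_integral (?N 0 - ?N t) / 2) {0..t}"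
    by (rule has_integral_eq_rhs[OF has_integral_eq, rotated 1]) (simp_all add: field_simps)
  have "integral {0..t} (\<lambda>s. (phi s)\<^sup>2 + lam s * inner \<xi> (y s - z)) \<le> (?N 0 - ?N t) / 2"
  proof (rule has_integral_le[OF integrable_integral *])
    have sub: "continuous_on {0..t} phi" "continuous_on {0..t} lam" "continuous_on {0..t} y"
      using phi_cont lam_cont y_cont by (auto elim: continuous_on_subset)
    show "(\<lambda>s. (phi s)\<^sup>2 + lam s * inner \<xi> (y s - z)) integrable_on {0..t}"
      by (intro integrable_continuous_interval continuous_intros sub)
  next
    fix s assume "s \<in> {0..t}"
    then have s: "0 \<le> s" by simp
    have "0 \<le> lam s * inner ((1 / lam s) *\<^sub>R (x s - y s) - \<xi>) (y s - z)"
      using maximal_monotoneD[OF maxmono mem_y[OF s] xi] lam_pos[OF s] by simp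
    also have "\<dots> = inner (x s - y s) (y s - z) - lam s * inner \<xi> (y s - z)"
      using lam_pos[OF s] by (simp add: inner_diff_left right_diff_distrib)
    \<comment> \<open>Splitting \<open>x s - z\<close> as \<open>(x s - y s) + (y s - z)\<close>
      produces the term \<open>(phi s)^2\<close>.\<close>
    finally show "(phi s)\<^sup>2 + lam s * inner \<xi> (y s - z) \<le> - inner (x s - z) (y s - x s)"
      unfolding phi_def power2_norm_eq_inner
      by (simp add: inner_diff_left inner_diff_right inner_commute)
  qed
  also have "\<dots> \<le> (norm (x 0 - z))\<^sup>2 / 2"
    by (simp add: power2_norm_eq_inner)
  finally show ?thesis .
qed

lemma phi_rate:
  assumes "0 \<in> A z"
  obtains K where "K > 0" "\<And>t. t > 0 \<Longrightarrow> phi t \<le> K * t powr (- 1 / 2)"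
proof -
  \<comment> \<open>The summand 1 keeps \<open>K\<close> positive, so that later it may be divided
    by.\<close>
  define K where "K = norm (x 0 - z) + 1"
  have K: "K > 0" by (simp add: K_def add_nonneg_pos)
  have "phi t \<le> K * t powr (- 1 / 2)" if t: "t > 0" for t
  proof -
    have int: "(\<lambda>s. (phi s)\<^sup>2) integrable_on {0..t}"
      by (intro integrable_continuous_interval continuous_intros continuous_on_subset[OF phi_cont]) auto
    have "t * (phi t)\<^sup>2 = integral {0..t} (\<lambda>s. (phi t)\<^sup>2)" using t by simp
    also have "\<dots> \<le> integral {0..t} (\<lambda>s. (phi s)\<^sup>2)"
      by (intro integral_le int) (auto intro!: power_mono phi_antimono phi_nonneg)
    also have "\<dots> \<le> (norm (x 0 - z))\<^sup>2 / 2"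
      using energy_integral_le[OF _ assms, of t] t by simp
    also have "\<dots> \<le> (norm (x 0 - z))\<^sup>2" by simp
    also have "\<dots> \<le> K\<^sup>2" by (intro power_mono) (auto simp: K_def)
    finally have "(phi t)\<^sup>2 \<le> K\<^sup>2 * (t powr (- 1 / 2))\<^sup>2"
      using t by (simp add: powr_power powr_minus field_simps)
    then have "(phi t)\<^sup>2 \<le> (K * t powr (- 1 / 2))\<^sup>2" by (simp add: power_mult_distrib)
    then show ?thesis by (rule power2_le_imp_le) (use K in simp)
  qed
  with K show thesis by (rule that)
qed

text \<open>Inserting the decay of \<open>phi\<close> into the constraint bounds
  \<open>lam s\<close> below by a multiple of \<open>s powr ((p - 1) / 2)\<close>; integration
  raises the exponent by one.\<close>

lemma lam_integral_rate:
  assumes "0 \<in> A z"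
  obtains c where "c > 0" "\<And>t. t > 0 \<Longrightarrow> c * t powr ((real p + 1) / 2) \<le> integral {0..t} lam"
proof -
  obtain K where K: "K > 0" "\<And>t. t > 0 \<Longrightarrow> phi t \<le> K * t powr (- 1 / 2)"
    using phi_rate[OF assms] by blast
  define a where "a = (real p - 1) / 2"
  define b where "b = theta / K ^ (p - 1)"
  have a: "a > -1" using p_ge by (simp add: a_def)
  then have a': "a + 1 > 0" by simp
  have b: "b > 0" using theta_pos K by (simp add: b_def)
  have lam: "b * s powr a \<le> lam s" if s: "s \<ge> 0" for s
  proof (cases "s = 0")
    case True
    \<comment> \<open>\<open>0 powr a\<close> is 0 even for \<open>a = 0\<close>, the case
      \<open>p = 1\<close>.\<close>
    then show ?thesis using lam_pos[OF s] by simp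
  next
    case False
    then have s0: "s > 0" using s by simp
    have "theta \<le> lam s * (K * s powr (- 1 / 2)) ^ (p - 1)"
      unfolding lam_phi[OF s, symmetric]
      using lam_pos[OF s] K(2)[OF s0] phi_nonneg by (intro mult_left_mono power_mono) auto
    also have "(K * s powr (- 1 / 2)) ^ (p - 1) = K ^ (p - 1) / s powr a"
      using s0 p_ge by (simp add: power_mult_distrib powr_power a_def of_nat_diff)
        (simp add: powr_minus_divide)
    finally show ?thesis
      using s0 K(1) by (simp add: b_def field_simps)
  qed
  have rate: "b / (a + 1) * t powr ((real p + 1) / 2) \<le> integral {0..t} lam" if t: "t > 0" for t
  proof -
    have "((\<lambda>s. s powr a) has_integral t powr (a + 1) / (a + 1)) {0..t}"
      using a t by (intro has_integral_powr_from_0) auto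
    then have "((\<lambda>s. b * s powr a) has_integral b * (t powr (a + 1) / (a + 1))) {0..t}"
      by (rule has_integral_mult_right)
    moreover have "lam integrable_on {0..t}"
      by (intro integrable_continuous_interval continuous_on_subset[OF lam_cont]) auto
    ultimately have "b * (t powr (a + 1) / (a + 1)) \<le> integral {0..t} lam"
      by (rule has_integral_le[OF _ integrable_integral]) (auto intro: lam)
    also have "a + 1 = (real p + 1) / 2" by (simp add: a_def field_simps)
    finally show ?thesis by (simp add: a_def field_simps)
  qed
  show thesis
    using that[of "b / (a + 1)"] a' b rate by simp
qed

text \<open>The infimum is bounded by the element \<open>(x t - y t) / lam t\<close> of
  \<open>A (y t)\<close>, whose norm is \<open>phi t ^ p / theta\<close> by the constraint.\<close>

lemma res_rate:
  assumes "0 \<in> A z"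
  obtains C where "\<And>t. t > 0 \<Longrightarrow> \<bar>res_fun A (y t)\<bar> \<le> ereal (C * t powr (- real p / 2))"
proof -
  obtain K where K: "K > 0" "\<And>t. t > 0 \<Longrightarrow> phi t \<le> K * t powr (- 1 / 2)"
    using phi_rate[OF assms] by blast
  have "\<bar>res_fun A (y t)\<bar> \<le> ereal (K ^ p / theta * t powr (- real p / 2))" if t: "t > 0" for t
  proof -
    have l: "lam t > 0" using lam_pos t by simp
    have "phi t / lam t = phi t ^ p / theta"
    proof -
      have "phi t * theta = lam t * (phi t * phi t ^ (p - 1))"
        using lam_phi[of t] t by (simp add: mult_ac)
      also have "phi t * phi t ^ (p - 1) = phi t ^ p"
        using p_ge by (metis Suc_pred' less_eq_Suc_le One_nat_def power_Suc)
      finally show ?thesis using l theta_pos by (simp add: field_simps)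
    qed
    have "0 \<le> res_fun A (y t)"
      unfolding res_fun_def by (intro INF_greatest) simp
    then have "\<bar>res_fun A (y t)\<bar> = res_fun A (y t)" by simp
    also have "\<dots> \<le> ereal (norm ((1 / lam t) *\<^sub>R (x t - y t)))"
      unfolding res_fun_def using t by (intro INF_lower mem_y) simp
    also have "norm ((1 / lam t) *\<^sub>R (x t - y t)) = phi t ^ p / theta"
      using l \<open>phi t / lam t = phi t ^ p / theta\<close> by (simp add: phi_def)
    also have "phi t ^ p \<le> (K * t powr (- 1 / 2)) ^ p"
      using K(2)[OF t] phi_nonneg by (rule power_mono)
    also have "(K * t powr (- 1 / 2)) ^ p = K ^ p * t powr (- real p / 2)"
      using t by (simp add: power_mult_distrib powr_power)
    finally show ?thesis using theta_pos by (simp add: divide_right_mono)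
  qed
  then show thesis by (rule that)
qed

lemma gap_rate:
  assumes zero: "0 \<in> A z0" and bdd: "bounded (dom_op A)"
  obtains C where "\<And>t. t > 0 \<Longrightarrow>
    \<bar>gap_fun A ((1 / integral {0..t} lam) *\<^sub>R integral {0..t} (\<lambda>s. lam s *\<^sub>R y s))\<bar>
      \<le> ereal (C * t powr (- (real p + 1) / 2))"
proof -
  obtain c where c: "c > 0" "\<And>t. t > 0 \<Longrightarrow> c * t powr ((real p + 1) / 2) \<le> integral {0..t} lam"
    using lam_integral_rate[OF zero] by blast
  obtain R where R: "\<And>z. z \<in> dom_op A \<Longrightarrow> norm z \<le> R"
    using bdd by (auto simp: bounded_iff)
  \<comment> \<open>\<open>R\<close> bounds the domain, so \<open>G\<close> bounds the initial
    energy \<open>(norm (x 0 - z))^2 / 2\<close> for every \<open>z\<close> in it.\<close>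
  define G where "G = (norm (x 0) + R)\<^sup>2 / 2"
  have "\<bar>gap_fun A ((1 / integral {0..t} lam) *\<^sub>R integral {0..t} (\<lambda>s. lam s *\<^sub>R y s))\<bar>
      \<le> ereal (G / c * t powr (- (real p + 1) / 2))" if t: "t > 0" for t
  proof -
    define L where "L = integral {0..t} lam"
    define w where "w = (1 / L) *\<^sub>R integral {0..t} (\<lambda>s. lam s *\<^sub>R y s)"
    have cont: "continuous_on {0..t} phi" "continuous_on {0..t} lam" "continuous_on {0..t} y"
      using phi_cont lam_cont y_cont by (auto elim: continuous_on_subset)
    have "0 < c * t powr ((real p + 1) / 2)" using c(1) t by simp
    then have L: "0 < L" "c * t powr ((real p + 1) / 2) \<le> L"
      using c(2)[OF t] by (auto simp: L_def)
    have inner_le: "inner \<xi> (w - z) \<le> G / c * t powr (- (real p + 1) / 2)" if xi: "\<xi> \<in> A z" for \<xi> z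
    proof -
      have z: "z \<in> dom_op A" using xi by (auto simp: dom_op_def)
      have "((\<lambda>s. lam s *\<^sub>R y s) has_integral (L *\<^sub>R w)) {0..t}"
      proof -
        have "(\<lambda>s. lam s *\<^sub>R y s) integrable_on {0..t}"
          by (intro integrable_continuous_hilbert continuous_intros cont)
        then show ?thesis using L(1) by (simp add: w_def has_integral_integral)
      qed
      moreover have lam_int: "(lam has_integral L) {0..t}"
        unfolding L_def by (intro integrable_integral integrable_continuous_interval cont)
      ultimately have "((\<lambda>s. lam s *\<^sub>R y s - lam s *\<^sub>R z) has_integral (L *\<^sub>R w - L *\<^sub>R z)) {0..t}"
        by (intro has_integral_diff has_integral_scaleR_left)
      from has_integral_linear[OF this bounded_linear_inner_right[of \<xi>]]
      have "((\<lambda>s. lam s * inner \<xi> (y s - z)) has_integral (L * inner \<xi> (w - z))) {0..t}"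
        by (simp add: o_def flip: scaleR_diff_right)
      \<comment> \<open>The nonnegative term \<open>(phi s)^2\<close> is added to reach the
        integrand of the energy estimate.\<close>
      then have "L * inner \<xi> (w - z) \<le> integral {0..t} (\<lambda>s. (phi s)\<^sup>2 + lam s * inner \<xi> (y s - z))"
        by (rule has_integral_le[OF _ integrable_integral])
          (auto intro!: integrable_continuous_interval continuous_intros cont)
      also have "\<dots> \<le> (norm (x 0 - z))\<^sup>2 / 2"
        using t xi by (intro energy_integral_le) auto
      also have "\<dots> \<le> G"
        unfolding G_def
        using R[OF z] norm_triangle_ineq4[of "x 0" z] by (intro divide_right_mono power_mono) auto
      finally have "inner \<xi> (w - z) \<le> G / L" using L by (simp add: field_simps)
      also have "\<dots> \<le> G / (c * t powr ((real p + 1) / 2))"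
        using L \<open>0 < c * t powr _\<close> by (intro divide_left_mono) (auto simp: G_def)
      also have "\<dots> = G / c * t powr (- (real p + 1) / 2)"
        unfolding minus_divide_left[symmetric] powr_minus_divide by simp
      finally show ?thesis .
    qed
    \<comment> \<open>The pair \<open>(z0, 0)\<close> competes in the supremum, so the gap is
      nonnegative and the absolute value drops.\<close>
    have "0 = ereal (inner 0 (w - z0))" by simp
    also have "\<dots> \<le> gap_fun A w"
      unfolding gap_fun_def using zero
      by (intro SUP_upper2[of z0] SUP_upper2[of 0]) (auto simp: dom_op_def)
    finally have "\<bar>gap_fun A w\<bar> = gap_fun A w" by simp
    also have "\<dots> \<le> ereal (G / c * t powr (- (real p + 1) / 2))"
      unfolding gap_fun_def using inner_le by (intro SUP_least) simp
    finally show ?thesis by (simp add: w_def L_def)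
  qed
  then show thesis by (rule that)
qed

end

theorem theorem3p3:
  fixes A :: "'a::{real_inner, complete_space} \<Rightarrow> 'a set"
    and theta :: real and p :: nat
    and x :: "real \<Rightarrow> 'a" and lam :: "real \<Rightarrow> real"
  assumes maxmono: "maximal_monotone A"
    and zeros: "\<exists>y. 0 \<in> A y"
    and dom_closed: "closed (dom_op A)"
    and dom_bounded: "bounded (dom_op A)"
    and theta_pos: "theta > 0"
    and p_ge: "p \<ge> 1"
    and lam_pos: "\<And>t. t \<ge> 0 \<Longrightarrow> lam t > 0"
    and lam_cont: "continuous_on {0..} lam"
    and ode: "\<And>t. t \<ge> 0 \<Longrightarrow>
       (x has_vector_derivative (resolvent A (lam t) (x t) - x t)) (at t within {0..})"
    and alg: "\<And>t. t \<ge> 0 \<Longrightarrow>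
       lam t * norm (resolvent A (lam t) (x t) - x t) ^ (p - 1) = theta"
    and init: "0 \<notin> A (x 0)"
  shows "(\<exists>C T. \<forall>t\<ge>T.
           \<bar>gap_fun A ((1 / integral {0..t} lam) *\<^sub>R
               integral {0..t} (\<lambda>s. lam s *\<^sub>R resolvent A (lam s) (x s)))\<bar>
             \<le> ereal (C * t powr (- (real p + 1) / 2))) \<and>
         (\<exists>C T. \<forall>t\<ge>T.
           \<bar>res_fun A (resolvent A (lam t) (x t))\<bar> \<le> ereal (C * t powr (- real p / 2)))"
proof -
  interpret resolvent_flow A theta p x lam
    by unfold_locales (use assms in auto)
  obtain z0 where z0: "0 \<in> A z0" using zeros by blast
  obtain C1 where C1: "\<And>t. t > 0 \<Longrightarrow>
      \<bar>gap_fun A ((1 / integral {0..t} lam) *\<^sub>R integral {0..t} (\<lambda>s. lam s *\<^sub>R y s))\<bar>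
        \<le> ereal (C1 * t powr (- (real p + 1) / 2))"
    using gap_rate[OF z0 dom_bounded] by blast
  obtain C2 where C2: "\<And>t. t > 0 \<Longrightarrow> \<bar>res_fun A (y t)\<bar> \<le> ereal (C2 * t powr (- real p / 2))"
    using res_rate[OF z0] by blast
  \<comment> \<open>Both rates hold for all \<open>t > 0\<close>; \<open>T = 1\<close> is a
    convenient threshold.\<close>
  have pos: "t > 0" if "t \<ge> 1" for t :: real using that by simp
  show ?thesis
    using C1[OF pos] C2[OF pos] unfolding y_def by blast
qed

end
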